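(* Let $\mu_h$ be a probability measure on $\mathbb{R}$ of the form $d\mu_h(x)=e^{-h(x)}\,dx$ with $h\colon\mathbb{R}\to\mathbb{R}$ a symmetric $\mathcal{C}^2$ function. Assume that there exist $c,C>0$ such that $c\le h''\le C$. Then, for any $\mathcal{C}^2$ function $f\colon\mathbb{R}\to(0,\infty)$ such that $(\log f)''\ge-\beta$ for some $\beta\ge0$, it holds $$\mu_h\Bigl(\Bigl\{f\ge t\int f\,d\mu_h\Bigr\}\Bigr)\le\Bigl(\frac{C+\beta}{c}\Bigr)\frac{1}{t\sqrt{\log t}},\qquad\forall t\ge2.$$
   Context: Symmetric means even: $h(-x)=h(x)$ for all $x$. If $\int f\,d\mu_h=+\infty$ the set on the left is empty. *)

theory Defs
  imports "HOL-Probability.Probability"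
begin

definition C2 :: "(real \<Rightarrow> real) \<Rightarrow> bool" where
  "C2 g \<longleftrightarrow> g differentiable_on UNIV \<and> deriv g differentiable_on UNIV
     \<and> continuous_on UNIV (deriv (deriv g))"

definition mu :: "(real \<Rightarrow> real) \<Rightarrow> real measure" where
  "mu h = density lborel (\<lambda>x. ennreal (exp (- h x)))"

end

theory Submission
  imports Defs "HOL-Real_Asymp.Real_Asymp"
begin

text \<open>Write \<open>K = C + \<beta>\<close>, \<open>F = \<integral> f d\<mu>\<^sub>h\<close> and \<open>\<psi> = ln f - h\<close>. Since \<open>\<psi>'' \<ge> -K\<close>, the
  function \<open>\<psi>\<close> lies above a downward parabola of curvature \<open>K\<close> touching its graph at any given
  point \<open>x\<close>, so that \<open>exp \<psi>\<close> dominates a multiple of a Gaussian density of variance \<open>1/K\<close> whose maximum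
  is at least \<open>exp (\<psi> x)\<close>. Integrating gives \<open>f x * exp (- h x) * sqrt (2 * pi / K) \<le> F\<close>
  (lemma \<open>exp_le_nn_integral_exp\<close>). If \<open>F\<close> is finite, \<open>{f \<ge> t * F}\<close> is contained in the superlevel set
  \<open>{h \<ge> s}\<close> with \<open>exp s = t * sqrt (2 * pi / K)\<close>.

  As \<open>h\<close> is even and \<open>h'' \<ge> c\<close>, this superlevel set consists of two tails starting at \<open>\<plusminus>a\<close>, where
  \<open>h a = s\<close>; on them \<open>\<bar>h'\<bar>\<close> is at least \<open>h' a \<ge> sqrt (2 * c * (s - h 0))\<close>, and comparing
  \<open>exp (- h)\<close> with \<open>h' * exp (- h) / h' a\<close> shows that the measure is at most
  \<open>2 * exp (- s) / sqrt (2 * c * (s - h 0))\<close> (lemma \<open>measure_mu_superlevel_le\<close>). Normalisation of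
  \<open>\<mu>\<^sub>h\<close> gives \<open>exp (h 0) \<le> sqrt (2 * pi / c)\<close>, hence \<open>s - h 0 \<ge> ln t - ln R / 2\<close> for
  \<open>R = K / c\<close>. If \<open>R \<ge> sqrt (ln t)\<close>, the claim is weaker than Markov's inequality; otherwise
  \<open>ln R\<close> is small compared with \<open>ln t\<close>, and the tail estimate yields the claim.\<close>

section \<open>Second-order bounds and Gaussian minorants\<close>

lemma C2_DERIV:
  assumes "C2 g"
  shows "(g has_real_derivative deriv g x) (at x)"
    and "(deriv g has_real_derivative deriv (deriv g) x) (at x)"
  using assms
  by (auto simp: C2_def differentiable_on_def DERIV_deriv_iff_real_differentiable)

lemma deriv_even_at_0:
  fixes h :: "real \<Rightarrow> real"
  assumes even: "\<And>x. h (- x) = h x" and h: "(h has_real_derivative D) (at 0)"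
  shows "D = 0"
proof -
  have "(h has_real_derivative - D) (at 0)"
    using DERIV_mirror[where f = h and x = 0 and y = D] h by (simp add: even)
  then have "- D = D" using h DERIV_unique by blast
  then show ?thesis by simp
qed

lemma second_order_lower_bound:
  fixes g g' g'' :: "real \<Rightarrow> real"
  assumes g: "\<And>x. (g has_real_derivative g' x) (at x)"
    and g': "\<And>x. (g' has_real_derivative g'' x) (at x)"
    and ge: "\<And>x. k \<le> g'' x"
  shows "g x + g' x * (y - x) + k / 2 * (y - x)\<^sup>2 \<le> g y"
proof -
  define G where "G = (\<lambda>z. g z - k / 2 * z\<^sup>2)"
  define G' where "G' = (\<lambda>z. g' z - k * z)"
  have G: "(G has_real_derivative G' z) (at z)" for z
    unfolding G_def G'_def by (auto intro!: derivative_eq_intros g)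
  have G': "(G' has_real_derivative g'' z - k) (at z)" for z
    unfolding G'_def by (auto intro!: derivative_eq_intros g')
  have "convex_on UNIV G"
    by (rule f''_ge0_imp_convex[where f' = G' and f'' = "\<lambda>z. g'' z - k"])
      (use G G' ge in auto)
  then have "G y - G x \<ge> G' x * (y - x)"
    by (rule convex_on_imp_above_tangent) (use G in auto)
  then show ?thesis
    by (simp add: G_def G'_def power2_eq_square field_simps)
qed

lemma nn_integral_gaussian:
  assumes "K > 0"
  shows "(\<integral>\<^sup>+ y. ennreal (exp (- K / 2 * (y - m)\<^sup>2)) \<partial>lborel) = ennreal (sqrt (2 * pi / K))"
proof -
  define \<sigma> where "\<sigma> = 1 / sqrt K"
  have \<sigma>: "\<sigma> > 0" "\<sigma>\<^sup>2 = 1 / K" using assms by (auto simp: \<sigma>_def power_divide)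
  have eq: "exp (- K / 2 * (y - m)\<^sup>2) = sqrt (2 * pi / K) * normal_density m \<sigma> y" for y
    using assms by (simp add: normal_density_def \<sigma> field_simps)
  have "(\<integral>\<^sup>+ y. ennreal (exp (- K / 2 * (y - m)\<^sup>2)) \<partial>lborel)
      = ennreal (sqrt (2 * pi / K)) * (\<integral>\<^sup>+ y. ennreal (normal_density m \<sigma> y) \<partial>lborel)"
    unfolding eq using assms \<sigma> by (simp add: ennreal_mult nn_integral_cmult)
  also have "(\<integral>\<^sup>+ y. ennreal (normal_density m \<sigma> y) \<partial>lborel) = 1"
    using prob_space.emeasure_space_1[OF prob_space_normal_density[OF \<sigma>(1), of m]]
    by (simp add: emeasure_density)
  finally show ?thesis by simp
qed

lemma exp_le_nn_integral_exp:
  fixes \<psi> \<psi>' \<psi>'' :: "real \<Rightarrow> real"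
  assumes "\<And>x. (\<psi> has_real_derivative \<psi>' x) (at x)"
    and "\<And>x. (\<psi>' has_real_derivative \<psi>'' x) (at x)"
    and "\<And>x. - K \<le> \<psi>'' x" and K: "K > 0"
  shows "ennreal (exp (\<psi> x) * sqrt (2 * pi / K)) \<le> (\<integral>\<^sup>+ y. ennreal (exp (\<psi> y)) \<partial>lborel)"
proof -
  \<comment> \<open>The vertex of the parabola of curvature \<open>- K\<close> that is tangent to \<open>\<psi>\<close> at \<open>x\<close>.\<close>
  define m where "m = x + \<psi>' x / K"
  have le: "\<psi> x + - K / 2 * (y - m)\<^sup>2 \<le> \<psi> y" for y
  proof -
    have "\<psi>' x * (y - x) + (- K) / 2 * (y - x)\<^sup>2 = - K / 2 * (y - m)\<^sup>2 + (\<psi>' x)\<^sup>2 / (2 * K)"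
      using K by (simp add: m_def power2_eq_square field_simps)
    moreover have "(\<psi>' x)\<^sup>2 / (2 * K) \<ge> 0" using K by simp
    ultimately show ?thesis
      using second_order_lower_bound[OF assms(1-3), of x y] by linarith
  qed
  have "ennreal (exp (\<psi> x) * sqrt (2 * pi / K))
      = (\<integral>\<^sup>+ y. ennreal (exp (\<psi> x)) * ennreal (exp (- K / 2 * (y - m)\<^sup>2)) \<partial>lborel)"
    using K by (simp add: nn_integral_cmult nn_integral_gaussian[OF K, simplified] ennreal_mult)
  also have "\<dots> \<le> (\<integral>\<^sup>+ y. ennreal (exp (\<psi> y)) \<partial>lborel)"
  proof (rule nn_integral_mono)
    fix y show "ennreal (exp (\<psi> x)) * ennreal (exp (- K / 2 * (y - m)\<^sup>2)) \<le> ennreal (exp (\<psi> y))"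
      using le[of y] by (subst ennreal_mult[symmetric]) (auto simp flip: exp_add intro!: ennreal_leI)
  qed
  finally show ?thesis .
qed

section \<open>Tails of strongly log-concave symmetric measures\<close>

text \<open>On \<open>[a, \<infinity>)\<close> the integrand is at most \<open>h' * exp (- h) / h' a\<close>, which has the explicit
  antiderivative \<open>- exp (- h) / h' a\<close>.\<close>

lemma nn_integral_exp_neg_tail_le:
  fixes h h' :: "real \<Rightarrow> real"
  assumes h: "\<And>x. (h has_real_derivative h' x) (at x)"
    and cont: "continuous_on UNIV h'"
    and mono: "\<And>x. a \<le> x \<Longrightarrow> h' a \<le> h' x"
    and pos: "0 < h' a"
    and lim: "filterlim h at_top at_top"
  shows "(\<integral>\<^sup>+ x. ennreal (exp (- h x)) * indicator {a..} x \<partial>lborel) \<le> ennreal (exp (- h a) / h' a)"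
proof -
  have [measurable]: "h \<in> borel_measurable borel" "h' \<in> borel_measurable borel"
    using h cont
    by (auto intro!: borel_measurable_continuous_onI DERIV_isCont continuous_at_imp_continuous_on)
  have "(\<integral>\<^sup>+ x. ennreal (exp (- h x)) * indicator {a..} x \<partial>lborel)
      \<le> (\<integral>\<^sup>+ x. ennreal (h' x * exp (- h x) / h' a) * indicator {a..} x \<partial>lborel)"
  proof (rule nn_integral_mono)
    fix x
    have "exp (- h x) \<le> h' x * exp (- h x) / h' a" if "a \<le> x"
      using mono[OF that] pos by (simp add: field_simps)
    then show "ennreal (exp (- h x)) * indicator {a..} x
        \<le> ennreal (h' x * exp (- h x) / h' a) * indicator {a..} x"
      by (auto simp: indicator_def intro!: ennreal_leI)
  qed
  also have "\<dots> = ennreal (0 - (- exp (- h a) / h' a))"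
  proof (rule nn_integral_FTC_atLeast[where F = "\<lambda>x. - exp (- h x) / h' a"])
    show "((\<lambda>x. - exp (- h x) / h' a) has_real_derivative h' x * exp (- h x) / h' a) (at x)"
      if "a \<le> x" for x using pos by (auto intro!: derivative_eq_intros h)
    show "0 \<le> h' x * exp (- h x) / h' a" if "a \<le> x" for x
      using mono[OF that] pos by simp
    have "((\<lambda>x. exp (- h x)) \<longlongrightarrow> 0) at_top"
      using lim by (intro filterlim_compose[OF exp_at_bot]) (simp add: filterlim_uminus_at_top)
    then show "((\<lambda>x. - exp (- h x) / h' a) \<longlongrightarrow> 0) at_top"
      using tendsto_divide[OF tendsto_minus tendsto_const, of "\<lambda>x. exp (- h x)" 0 at_top "h' a"] pos
      by simp
  qed simp
  finally show ?thesis by simp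
qed

text \<open>The strict inequality \<open>h 0 < s\<close> is what keeps the slope \<open>h' a\<close> at the boundary \<open>a\<close> of the
  superlevel set positive.\<close>

lemma measure_mu_superlevel_le:
  fixes h h' h'' :: "real \<Rightarrow> real"
  assumes h: "\<And>x. (h has_real_derivative h' x) (at x)"
    and h': "\<And>x. (h' has_real_derivative h'' x) (at x)"
    and ge: "\<And>x. c \<le> h'' x" and c: "c > 0"
    and even: "\<And>x. h (- x) = h x"
    and s: "h 0 < s"
  shows "emeasure (mu h) {x. s \<le> h x} \<le> ennreal (2 * exp (- s) / sqrt (2 * c * (s - h 0)))"
proof -
  have conth: "continuous_on UNIV h" "continuous_on UNIV h'"
    using h h' by (auto intro!: DERIV_isCont continuous_at_imp_continuous_on)
  have [measurable]: "h \<in> borel_measurable borel"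
    using conth by (intro borel_measurable_continuous_onI)
  note taylor = second_order_lower_bound[OF h h' ge]
  have mono: "h' x \<le> h' y" if "x \<le> y" for x y
    by (rule DERIV_nonneg_imp_nondecreasing[OF that]) (use h' ge c in \<open>meson less_imp_le order_trans\<close>)
  have h'0: "h' 0 = 0" by (rule deriv_even_at_0[OF even h])
  have quad: "h 0 + c / 2 * x\<^sup>2 \<le> h x" for x
    using taylor[of 0 x] h'0 by simp
  have lim: "filterlim h at_top at_top"
  proof (rule filterlim_at_top_mono)
    show "filterlim (\<lambda>x. h 0 + c / 2 * x\<^sup>2) at_top at_top"
      using c by real_asymp
    show "eventually (\<lambda>x. h 0 + c / 2 * x\<^sup>2 \<le> h x) at_top" using quad by simp
  qed
  obtain a where a: "a \<ge> 0" "h a = s"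
  proof -
    obtain b where b: "b \<ge> 0" "s \<le> h b"
      using eventually_conj[OF filterlim_at_top[THEN iffD1, OF lim, rule_format, of s]
          eventually_ge_at_top[of 0]] eventually_happens[of _ at_top] by force
    have "\<exists>a\<ge>0. a \<le> b \<and> h a = s"
      by (rule IVT') (use b s conth(1) in \<open>auto intro: continuous_on_subset\<close>)
    then show ?thesis using that by auto
  qed
  have h'a_nn: "h' a \<ge> 0" using mono[of 0 a] a h'0 by simp
  have h'a: "sqrt (2 * c * (s - h 0)) \<le> h' a"
  proof (rule real_le_lsqrt[OF h'a_nn])
    \<comment> \<open>Expand around \<open>a\<close>, evaluate at \<open>0\<close>, and complete the square in \<open>a\<close>.\<close>
    have "s - h 0 \<le> h' a * a - c / 2 * a\<^sup>2" using taylor[of a 0] a by simp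
    then have "2 * c * (s - h 0) \<le> 2 * c * (h' a * a - c / 2 * a\<^sup>2)"
      using c by (intro mult_left_mono) auto
    also have "\<dots> = (h' a)\<^sup>2 - (h' a - c * a)\<^sup>2" by (simp add: power2_eq_square algebra_simps)
    also have "\<dots> \<le> (h' a)\<^sup>2" by simp
    finally show "2 * c * (s - h 0) \<le> (h' a)\<^sup>2" .
  qed
  have root_pos: "sqrt (2 * c * (s - h 0)) > 0" using c s by simp
  have sub: "a \<le> \<bar>x\<bar>" if "s \<le> h x" for x
  proof (rule ccontr)
    assume "\<not> a \<le> \<bar>x\<bar>"
    then have lt: "\<bar>x\<bar> < a" by simp
    have "h' \<bar>x\<bar> \<ge> 0" using mono[of 0 "\<bar>x\<bar>"] h'0 by simp
    then have "h' \<bar>x\<bar> * (a - \<bar>x\<bar>) \<ge> 0" using lt by simp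
    moreover have "c / 2 * (a - \<bar>x\<bar>)\<^sup>2 > 0" using c lt by simp
    ultimately have "h \<bar>x\<bar> < h a" using taylor[of "\<bar>x\<bar>" a] by linarith
    moreover have "h \<bar>x\<bar> = h x" using even by (simp add: abs_if)
    ultimately show False using that a by simp
  qed
  let ?I = "\<integral>\<^sup>+ x. ennreal (exp (- h x)) * indicator {a..} x \<partial>lborel"
  have "emeasure (mu h) {x. s \<le> h x}
      = (\<integral>\<^sup>+ x. ennreal (exp (- h x)) * indicator {x. s \<le> h x} x \<partial>lborel)"
    unfolding mu_def by (subst emeasure_density) auto
  also have "\<dots> \<le> (\<integral>\<^sup>+ x. ennreal (exp (- h x)) * indicator {a..} x
      + ennreal (exp (- h (- x))) * indicator {a..} (- x) \<partial>lborel)"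
  proof (rule nn_integral_mono)
    fix x
    have "a \<le> x \<or> a \<le> - x" if "s \<le> h x" using sub[OF that] by linarith
    then show "ennreal (exp (- h x)) * indicator {x. s \<le> h x} x
        \<le> ennreal (exp (- h x)) * indicator {a..} x
          + ennreal (exp (- h (- x))) * indicator {a..} (- x)"
      by (auto simp: indicator_def even)
  qed
  also have "\<dots> = ?I + (\<integral>\<^sup>+ x. ennreal (exp (- h (- x))) * indicator {a..} (- x) \<partial>lborel)"
    by (intro nn_integral_add) measurable
  also have "(\<integral>\<^sup>+ x. ennreal (exp (- h (- x))) * indicator {a..} (- x) \<partial>lborel) = ?I"
    by (subst (2) nn_integral_real_affine[where c = "-1" and t = 0]) auto
  also have "?I + ?I \<le> ennreal (exp (- s) / h' a) + ennreal (exp (- s) / h' a)"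
    using nn_integral_exp_neg_tail_le[OF h conth(2) mono _ lim, of a] h'a root_pos a
    by (intro add_mono) auto
  also have "\<dots> = ennreal (2 * exp (- s) / h' a)"
    using h'a_nn by (simp flip: ennreal_plus)
  also have "\<dots> \<le> ennreal (2 * exp (- s) / sqrt (2 * c * (s - h 0)))"
    using h'a root_pos less_le_trans[OF root_pos h'a]
    by (intro ennreal_leI divide_left_mono mult_pos_pos) auto
  finally show ?thesis .
qed

text \<open>The density of \<open>\<mu>\<^sub>h\<close> lies below \<open>exp (- h 0) * exp (- c / 2 * x\<^sup>2)\<close> and has integral 1, which
  bounds \<open>h 0\<close> from above.\<close>

lemma exp_h0_le:
  assumes prob: "prob_space (mu h)"
    and meas [measurable]: "h \<in> borel_measurable borel"
    and quad: "\<And>x. h 0 + c / 2 * x\<^sup>2 \<le> h x" and c: "c > 0"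
  shows "exp (h 0) \<le> sqrt (2 * pi / c)"
proof -
  have "1 = emeasure (mu h) (space (mu h))" using prob by (simp add: prob_space.emeasure_space_1)
  also have "\<dots> = (\<integral>\<^sup>+ x. ennreal (exp (- h x)) \<partial>lborel)"
    unfolding mu_def by (subst emeasure_density) auto
  also have "\<dots> \<le> (\<integral>\<^sup>+ x. ennreal (exp (- h 0)) * ennreal (exp (- c / 2 * (x - 0)\<^sup>2)) \<partial>lborel)"
  proof (rule nn_integral_mono)
    fix x show "ennreal (exp (- h x)) \<le> ennreal (exp (- h 0)) * ennreal (exp (- c / 2 * (x - 0)\<^sup>2))"
      using quad[of x] by (subst ennreal_mult[symmetric]) (auto simp flip: exp_add intro!: ennreal_leI)
  qed
  also have "\<dots> = ennreal (exp (- h 0) * sqrt (2 * pi / c))"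
    using c by (simp add: nn_integral_cmult nn_integral_gaussian[OF c, of 0, simplified] ennreal_mult)
  finally have "1 \<le> exp (- h 0) * sqrt (2 * pi / c)"
    by (metis ennreal_1 ennreal_le_iff2 not_one_le_zero)
  then show ?thesis by (simp add: exp_minus field_simps)
qed

section \<open>The deviation inequality\<close>

text \<open>With \<open>R = (C + \<beta>) / c\<close>, \<open>L = ln t\<close> and \<open>d = s - h 0\<close>, the bound of
  \<open>measure_mu_superlevel_le\<close> equals \<open>sqrt (R / (pi * d)) / t\<close>. Here it is compared with the claim in
  the regime \<open>R < sqrt L\<close> left open by Markov's inequality; there \<open>ln R / 2 \<le> L / 4\<close>.\<close>

lemma tail_estimate_le:
  fixes R L d :: real
  assumes "1 \<le> R" "R < sqrt L" "L - ln R / 2 \<le> d"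
  shows "0 < d" and "sqrt (R / (pi * d)) \<le> R / sqrt L"
proof -
  have sqL: "1 < sqrt L" using assms by linarith
  then have L: "1 < L" by simp
  have "ln R \<le> ln (sqrt L)" using assms by (intro ln_mono) auto
  also have "\<dots> = ln L / 2" using L by (simp add: ln_sqrt)
  also have "\<dots> \<le> L / 2" using ln_le_minus_one[of L] L by simp
  finally have d: "3 / 4 * L \<le> d" using assms by simp
  then show d0: "0 < d" using L by linarith
  have "L \<le> 3 * (3 / 4 * L)" using L by simp
  also have "\<dots> \<le> pi * d" using d pi_gt3 L by (intro mult_mono) auto
  also have "\<dots> \<le> R * (pi * d)" using assms d0 by simp
  finally have *: "L \<le> R * (pi * d)" .
  have "R / (pi * d) \<le> R\<^sup>2 / L"
    using mult_left_mono[OF *, of R] assms(1) L d0 by (simp add: field_simps power2_eq_square)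
  then have "sqrt (R / (pi * d)) \<le> sqrt (R\<^sup>2 / L)" by simp
  then show "sqrt (R / (pi * d)) \<le> R / sqrt L"
    using assms(1) by (simp add: real_sqrt_divide)
qed

(* The integral of f may be infinite, hence the comparison is made in ennreal;
   as f is finite-valued and t > 0, the set is then empty. *)
theorem theorem2p3:
  fixes h f :: "real \<Rightarrow> real" and c C \<beta> t :: real
  assumes "prob_space (mu h)"
    and "C2 h"
    and "\<And>x. h (- x) = h x"
    and "c > 0" and "C > 0"
    and "\<And>x. c \<le> deriv (deriv h) x \<and> deriv (deriv h) x \<le> C"
    and "C2 f"
    and "\<And>x. f x > 0"
    and "\<beta> \<ge> 0"
    and "\<And>x. deriv (deriv (\<lambda>y. ln (f y))) x \<ge> - \<beta>"
    and "t \<ge> 2"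
  shows "measure (mu h) {x. ennreal (f x) \<ge> ennreal t * (\<integral>\<^sup>+ y. ennreal (f y) \<partial>mu h)}
           \<le> ((C + \<beta>) / c) * (1 / (t * sqrt (ln t)))"
proof -
  note h = C2_DERIV[OF assms(2)] and f = C2_DERIV[OF assms(7)]
  note even = assms(3) and c = assms(4) and hess = assms(6) and f_pos = assms(8) and t = assms(11)
  interpret prob_space "mu h" by (fact assms(1))
  have sets_mu [measurable_cong]: "sets (mu h) = sets borel" by (simp add: mu_def)
  have [measurable]: "h \<in> borel_measurable borel" "f \<in> borel_measurable borel"
    using h(1) f(1)
    by (auto intro!: borel_measurable_continuous_onI DERIV_isCont continuous_at_imp_continuous_on)
  define K R where "K = C + \<beta>" and "R = K / c"
  have "c \<le> C" using hess[of 0] by linarith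
  then have K: "K > 0" "c \<le> K" using c assms(9) by (auto simp: K_def)
  then have R: "R \<ge> 1" using c by (simp add: R_def)
  define I where "I = (\<integral>\<^sup>+ y. ennreal (f y) \<partial>mu h)"
  define A where "A = {x. ennreal t * I \<le> ennreal (f x)}"
  have goal: ?thesis if "measure (mu h) A \<le> R / sqrt (ln t) / t"
    using that unfolding A_def I_def R_def K_def by (simp add: ac_simps)

  define \<psi> where "\<psi> = (\<lambda>x. ln (f x) - h x)"
  define l' where "l' = (\<lambda>x. deriv f x / f x)"
  have l: "((\<lambda>y. ln (f y)) has_real_derivative l' x) (at x)" for x
    using DERIV_chain2[OF DERIV_ln_divide[OF f_pos] f(1)] by (simp add: l'_def)
  then have deriv_l: "deriv (\<lambda>y. ln (f y)) = l'" by (intro ext DERIV_imp_deriv)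
  have "l' differentiable (at x)" for x
    unfolding l'_def using f f_pos[of x]
    by (intro differentiable_divide) (auto simp: real_differentiable_def)
  then have l': "(l' has_real_derivative deriv l' x) (at x)" for x
    by (simp add: DERIV_deriv_iff_real_differentiable)
  have l'': "deriv l' x \<ge> - \<beta>" for x using assms(10)[of x] by (simp add: deriv_l)
  have exp_\<psi>: "exp (\<psi> x) = f x * exp (- h x)" for x
    using f_pos[of x] by (simp add: \<psi>_def exp_diff exp_minus field_simps)
  have I_lborel: "I = (\<integral>\<^sup>+ y. ennreal (exp (\<psi> y)) \<partial>lborel)"
    unfolding I_def mu_def using f_pos
    by (subst nn_integral_density) (auto simp: exp_\<psi> ennreal_mult less_imp_le mult.commute)
  have density_le: "ennreal (exp (\<psi> x) * sqrt (2 * pi / K)) \<le> I" for x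
    unfolding I_lborel
  proof (rule exp_le_nn_integral_exp[OF _ _ _ K(1)])
    show "(\<psi> has_real_derivative l' y - deriv h y) (at y)" for y
      unfolding \<psi>_def by (rule DERIV_diff[OF l h(1)])
    show "((\<lambda>y. l' y - deriv h y) has_real_derivative deriv l' y - deriv (deriv h) y) (at y)" for y
      by (rule DERIV_diff[OF l' h(2)])
    show "- K \<le> deriv l' y - deriv (deriv h) y" for y
      using hess[of y] l''[of y] by (simp add: K_def)
  qed

  show ?thesis
  proof (cases "I = \<infinity>")
    case True
    then have "A = {}" using t by (auto simp: A_def ennreal_mult_top top_unique)
    then show ?thesis using R t by (intro goal) auto
  next
    case False
    define F where "F = enn2real I"
    have I: "I = ennreal F" and F_nn: "F \<ge> 0" using False by (auto simp: F_def less_top)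
    have F_ge: "exp (\<psi> x) * sqrt (2 * pi / K) \<le> F" for x
      using density_le[of x] F_nn by (simp add: I ennreal_le_iff)
    have "0 < exp (\<psi> 0) * sqrt (2 * pi / K)" using K by simp
    then have F: "F > 0" using F_ge[of 0] by linarith
    have A: "A = {x. t * F \<le> f x}"
      using t F f_pos by (simp add: A_def I less_imp_le flip: ennreal_mult)
    have A_meas: "A \<in> sets (mu h)" unfolding A by measurable
    show ?thesis
    proof (cases "R < sqrt (ln t)")
      case False
      have "ennreal (t * F) * emeasure (mu h) A = (\<integral>\<^sup>+ x. ennreal (t * F) * indicator A x \<partial>mu h)"
        using A_meas by (simp add: nn_integral_cmult_indicator)
      also have "\<dots> \<le> I"
        unfolding I_def A by (intro nn_integral_mono) (auto simp: indicator_def intro!: ennreal_leI)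
      finally have "ennreal (t * F * measure (mu h) A) \<le> ennreal F"
        using t F by (simp add: I emeasure_eq_measure ennreal_mult)
      then have "t * measure (mu h) A \<le> 1" using F by (simp add: ennreal_le_iff)
      also have "1 \<le> R / sqrt (ln t)" using False t by simp
      finally show ?thesis using t by (intro goal) (simp add: field_simps)
    next
      case True
      define s where "s = ln (t * sqrt (2 * pi / K))"
      have exp_s: "exp s = t * sqrt (2 * pi / K)" using t K by (simp add: s_def)
      have sub: "A \<subseteq> {x. s \<le> h x}"
      proof
        fix x assume "x \<in> A"
        then have "t * F \<le> f x" by (simp add: A)
        also have "f x = exp (\<psi> x) * exp (h x)" by (simp add: exp_\<psi> exp_minus)
        finally have "t * F * sqrt (2 * pi / K) \<le> exp (\<psi> x) * exp (h x) * sqrt (2 * pi / K)"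
          using K by (intro mult_right_mono) auto
        also have "\<dots> \<le> F * exp (h x)" using F_ge[of x] by (simp add: ac_simps)
        finally have "exp s \<le> exp (h x)" using F by (simp add: exp_s ac_simps)
        then show "x \<in> {x. s \<le> h x}" by simp
      qed
      have h'0: "deriv h 0 = 0" by (rule deriv_even_at_0[OF even h(1)])
      have quad: "h 0 + c / 2 * x\<^sup>2 \<le> h x" for x
        using second_order_lower_bound[OF h, of c 0 x] hess h'0 by simp
      have "h 0 \<le> ln (sqrt (2 * pi / c))"
        using exp_h0_le[OF assms(1) _ quad c] c by (simp add: ln_ge_iff)
      moreover have "s = ln t + ln (sqrt (2 * pi / K))" using t K by (simp add: s_def ln_mult)
      moreover have "ln (sqrt (2 * pi / c)) = ln (sqrt (2 * pi / K)) + ln R / 2"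
        using c K by (simp add: R_def ln_sqrt ln_div ln_mult field_simps)
      ultimately have d: "ln t - ln R / 2 \<le> s - h 0" by linarith
      note est = tail_estimate_le[OF R True d]
      have tail_eq: "2 * exp (- s) / sqrt (2 * c * (s - h 0)) = sqrt (R / (pi * (s - h 0))) / t"
      proof -
        have exp_neg: "2 * exp (- s) = sqrt (4 * K / (2 * pi)) / t"
        proof -
          have "4 * K / (2 * pi) = 2\<^sup>2 * inverse (2 * pi / K)" by simp
          then have "sqrt (4 * K / (2 * pi)) = sqrt (2\<^sup>2) * inverse (sqrt (2 * pi / K))"
            by (simp only: real_sqrt_mult real_sqrt_inverse)
          then have root: "sqrt (4 * K / (2 * pi)) = 2 * inverse (sqrt (2 * pi / K))"
            by (simp only: real_sqrt_abs abs_numeral)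
          have "exp (- s) = inverse (sqrt (2 * pi / K)) / t"
            by (simp only: exp_minus exp_s inverse_mult_distrib divide_inverse mult.commute)
          then show ?thesis by (simp only: root times_divide_eq_right)
        qed
        have ratio: "4 * K / (2 * pi) / (2 * c * (s - h 0)) = R / (pi * (s - h 0))"
          using c est(1) by (simp add: R_def)
        have "2 * exp (- s) / sqrt (2 * c * (s - h 0))
            = sqrt (4 * K / (2 * pi)) / sqrt (2 * c * (s - h 0)) / t"
          by (simp add: exp_neg)
        also have "\<dots> = sqrt (4 * K / (2 * pi) / (2 * c * (s - h 0))) / t"
          by (simp only: real_sqrt_divide)
        finally show ?thesis by (simp only: ratio)
      qed
      have "ennreal (measure (mu h) A) = emeasure (mu h) A" by (simp add: emeasure_eq_measure)
      also have "\<dots> \<le> emeasure (mu h) {x. s \<le> h x}"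
        by (rule emeasure_mono[OF sub]) measurable
      also have "\<dots> \<le> ennreal (2 * exp (- s) / sqrt (2 * c * (s - h 0)))"
        by (rule measure_mu_superlevel_le[OF h _ c even]) (use hess est(1) in auto)
      finally have "ennreal (measure (mu h) A) \<le> ennreal (sqrt (R / (pi * (s - h 0))) / t)"
        by (simp only: tail_eq)
      moreover have "0 \<le> sqrt (R / (pi * (s - h 0))) / t" using R t est(1) by simp
      ultimately have "measure (mu h) A \<le> sqrt (R / (pi * (s - h 0))) / t"
        by (simp only: ennreal_le_iff)
      also have "\<dots> \<le> R / sqrt (ln t) / t" using est(2) t by (intro divide_right_mono) auto
      finally show ?thesis by (rule goal)
    qed
  qed
qed

end
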